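(* Every quasicontinuous dcpo is $C_{\sigma}$-unique.
   Context: A dcpo (directed complete poset) is a poset in which every directed (in particular nonempty) subset has a supremum. For a poset $P$ and $A\subseteq P$, $\downarrow A=\{x\in P: x\le y\text{ for some }y\in A\}$ and $\uparrow A=\{x\in P: y\le x\text{ for some }y\in A\}$. A subset $A$ of a dcpo $P$ is Scott closed if $A=\downarrow A$ and $\bigvee D\in A$ for every directed $D\subseteq A$. $C_{\sigma}(P)$ is the lattice of all Scott closed subsets of $P$ (including $\emptyset$), ordered by inclusion. A dcpo $P$ is $C_{\sigma}$-unique if for every dcpo $Q$, whenever the lattices $C_{\sigma}(P)$ and $C_{\sigma}(Q)$ are isomorphic, $P$ and $Q$ are order-isomorphic. For a finite subset $F$ of a dcpo $P$ and $a\in P$, write $F\ll a$ if for every directed $D\subseteq P$, $a\le\bigvee D$ implies $D\cap\uparrow F\ne\emptyset$. A dcpo $P$ is quasicontinuous if for every $x\in P$ the family $\mathit{fin}(x)=\{F: F\text{ is finite and }F\ll x\}$ is directed (it is nonempty and for any $F_1,F_2\in \mathit{fin}(x)$ there is $F\in \mathit{fin}(x)$ with $F\subseteq\uparrow F_1\cap\uparrow F_2$), and for every $y\in P$ with $x\not\le y$ there is $F\in \mathit{fin}(x)$ with $y\notin\uparrow F$. *)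

theory Defs
  imports Main
begin

text \<open>
  A poset is a carrier \<open>P\<close> with a relation \<open>r\<close> such that \<open>partial_order_on P r\<close>, which
  includes \<open>r \<subseteq> P \<times> P\<close>; \<open>(x, y) \<in> r\<close> means \<open>x \<le> y\<close>. The carrier may be empty.
\<close>

definition down_set :: "'a set \<Rightarrow> 'a rel \<Rightarrow> 'a set \<Rightarrow> 'a set" where
  "down_set P r A = {x \<in> P. \<exists>y\<in>A. (x, y) \<in> r}"

definition up_set :: "'a set \<Rightarrow> 'a rel \<Rightarrow> 'a set \<Rightarrow> 'a set" where
  "up_set P r A = {x \<in> P. \<exists>y\<in>A. (y, x) \<in> r}"

definition directed_in :: "'a set \<Rightarrow> 'a rel \<Rightarrow> 'a set \<Rightarrow> bool" where
  "directed_in P r D \<longleftrightarrow>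
     D \<subseteq> P \<and> D \<noteq> {} \<and> (\<forall>x\<in>D. \<forall>y\<in>D. \<exists>z\<in>D. (x, z) \<in> r \<and> (y, z) \<in> r)"

definition is_sup :: "'a set \<Rightarrow> 'a rel \<Rightarrow> 'a set \<Rightarrow> 'a \<Rightarrow> bool" where
  "is_sup P r A s \<longleftrightarrow>
     s \<in> P \<and> (\<forall>x\<in>A. (x, s) \<in> r) \<and> (\<forall>u\<in>P. (\<forall>x\<in>A. (x, u) \<in> r) \<longrightarrow> (s, u) \<in> r)"

definition dcpo :: "'a set \<Rightarrow> 'a rel \<Rightarrow> bool" where
  "dcpo P r \<longleftrightarrow>
     partial_order_on P r \<and> (\<forall>D. directed_in P r D \<longrightarrow> (\<exists>s. is_sup P r D s))"

text \<open>
  Suprema are unique in a poset and exist for directed subsets of a dcpo, so below a condition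
  on the supremum of \<open>D\<close> is imposed on every \<open>s\<close> with \<open>is_sup P r D s\<close>.
\<close>

definition scott_closed :: "'a set \<Rightarrow> 'a rel \<Rightarrow> 'a set \<Rightarrow> bool" where
  "scott_closed P r A \<longleftrightarrow>
     A \<subseteq> P \<and> A = down_set P r A \<and>
     (\<forall>D s. directed_in P r D \<and> D \<subseteq> A \<and> is_sup P r D s \<longrightarrow> s \<in> A)"

definition C_sigma :: "'a set \<Rightarrow> 'a rel \<Rightarrow> 'a set set" where
  "C_sigma P r = {A. scott_closed P r A}"

definition order_isomorphic :: "'a set \<Rightarrow> 'a rel \<Rightarrow> 'b set \<Rightarrow> 'b rel \<Rightarrow> bool" where
  "order_isomorphic P r Q s \<longleftrightarrow>
     (\<exists>f. bij_betw f P Q \<and> (\<forall>x\<in>P. \<forall>y\<in>P. (x, y) \<in> r \<longleftrightarrow> (f x, f y) \<in> s))"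

definition inclusion_on :: "'a set set \<Rightarrow> 'a set rel" where
  "inclusion_on \<A> = relation_of (\<subseteq>) \<A>"

text \<open>
  HOL cannot quantify over types inside a formula, so the type \<open>'b\<close> over which the dcpos \<open>Q\<close>
  range is a parameter; being \<open>C\<^sub>\<sigma>\<close>-unique means that this holds for every type \<open>'b\<close>.
  Since the lattices are ordered by inclusion and lattice isomorphisms are the same as order
  isomorphisms, \<open>order_isomorphic\<close> serves for both isomorphism relations.
\<close>

definition C_sigma_unique :: "'b itself \<Rightarrow> 'a set \<Rightarrow> 'a rel \<Rightarrow> bool" where
  "C_sigma_unique (_ :: 'b itself) P r \<longleftrightarrow>
     dcpo P r \<and>
     (\<forall>(Q :: 'b set) s. dcpo Q s \<longrightarrow>
        order_isomorphic (C_sigma P r) (inclusion_on (C_sigma P r))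
                         (C_sigma Q s) (inclusion_on (C_sigma Q s)) \<longrightarrow>
        order_isomorphic P r Q s)"

definition way_below :: "'a set \<Rightarrow> 'a rel \<Rightarrow> 'a set \<Rightarrow> 'a \<Rightarrow> bool" where
  "way_below P r F a \<longleftrightarrow>
     (\<forall>D s. directed_in P r D \<and> is_sup P r D s \<and> (a, s) \<in> r \<longrightarrow> D \<inter> up_set P r F \<noteq> {})"

definition fin :: "'a set \<Rightarrow> 'a rel \<Rightarrow> 'a \<Rightarrow> 'a set set" where
  "fin P r x = {F. F \<subseteq> P \<and> finite F \<and> way_below P r F x}"

definition quasicontinuous :: "'a set \<Rightarrow> 'a rel \<Rightarrow> bool" where
  "quasicontinuous P r \<longleftrightarrow>
     dcpo P r \<and>
     (\<forall>x\<in>P.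
        fin P r x \<noteq> {} \<and>
        (\<forall>F1\<in>fin P r x. \<forall>F2\<in>fin P r x. \<exists>F\<in>fin P r x. F \<subseteq> up_set P r F1 \<inter> up_set P r F2) \<and>
        (\<forall>y\<in>P. (x, y) \<notin> r \<longrightarrow> (\<exists>F\<in>fin P r x. y \<notin> up_set P r F)))"

end

theory Submission
  imports Defs
begin

text \<open>
  Call a dcpo locally hypercompact if every Scott open neighbourhood \<open>U\<close> of a point \<open>x\<close> contains
  a finite set \<open>F\<close> such that \<open>x\<close> lies in the Scott interior of \<open>\<up>F\<close>. The argument factors
  through this property for three reasons.

  First, a quasicontinuous dcpo has it (\<open>quasicontinuous_imp_locally_hypercompact\<close>): the members
  of \<open>fin x\<close> serve as the sets \<open>F\<close>, and \<open>{y. F \<lless> y}\<close> is Scott open by interpolation.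

  Second, it depends only on the lattice of Scott closed sets
  (\<open>locally_hypercompact_transfer\<close>). Given an isomorphism \<open>\<phi>\<close> onto the Scott closed sets of \<open>Q\<close>, the
  set \<open>\<phi> (\<down>f)\<close>, \<open>f \<in> F\<close>, is not yet known to be a principal ideal, but any point of it that lies in
  the given neighbourhood can take the place of a generator, because passing to a smaller point
  only enlarges the upper set.

  Third, in a locally hypercompact dcpo every irreducible Scott closed set is a principal ideal
  (\<open>irreducible_closed_is_principal\<close>), that is, the Scott topology is sober. Irreducibility is a
  lattice notion and principal ideals are irreducible, so a lattice isomorphism between the Scott
  closed sets of \<open>P\<close> and \<open>Q\<close> matches the principal ideals of \<open>P\<close> with those of \<open>Q\<close>. As
  \<open>x \<le> y\<close> means \<open>\<down>x \<subseteq> \<down>y\<close>, this gives \<open>P \<cong> Q\<close>.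

  Finite sets are turned into actual directed sets by Rudin's lemma (\<open>rudin\<close>), which is used
  in the first and in the third step.
\<close>

section \<open>Scott closed sets\<close>

lemma dcpo_refl: "dcpo P r \<Longrightarrow> x \<in> P \<Longrightarrow> (x, x) \<in> r"
  by (auto simp: dcpo_def partial_order_on_def preorder_on_def refl_on_def)

lemma dcpo_trans: "dcpo P r \<Longrightarrow> (x, y) \<in> r \<Longrightarrow> (y, z) \<in> r \<Longrightarrow> (x, z) \<in> r"
  unfolding dcpo_def partial_order_on_def preorder_on_def by (blast dest: transD)

lemma dcpo_antisym: "dcpo P r \<Longrightarrow> (x, y) \<in> r \<Longrightarrow> (y, x) \<in> r \<Longrightarrow> x = y"
  unfolding dcpo_def partial_order_on_def by (blast dest: antisymD)

lemma dcpo_carrier: "dcpo P r \<Longrightarrow> (x, y) \<in> r \<Longrightarrow> x \<in> P \<and> y \<in> P"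
  by (auto simp: dcpo_def partial_order_on_def preorder_on_def)

lemma dcpo_sup:
  assumes "dcpo P r" "directed_in P r D"
  obtains a where "is_sup P r D a"
  using assms by (auto simp: dcpo_def)

lemma C_sigma_lower: "A \<in> C_sigma P r \<Longrightarrow> y \<in> A \<Longrightarrow> (x, y) \<in> r \<Longrightarrow> x \<in> P \<Longrightarrow> x \<in> A"
  unfolding C_sigma_def scott_closed_def down_set_def by blast

lemma C_sigma_sup:
  "A \<in> C_sigma P r \<Longrightarrow> directed_in P r D \<Longrightarrow> D \<subseteq> A \<Longrightarrow> is_sup P r D a \<Longrightarrow> a \<in> A"
  unfolding C_sigma_def scott_closed_def by blast

lemma C_sigma_carrier: "A \<in> C_sigma P r \<Longrightarrow> A \<subseteq> P"
  unfolding C_sigma_def scott_closed_def by blast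

lemma C_sigmaI:
  assumes "dcpo P r" "A \<subseteq> P"
    and "\<And>x y. y \<in> A \<Longrightarrow> (x, y) \<in> r \<Longrightarrow> x \<in> A"
    and "\<And>D a. directed_in P r D \<Longrightarrow> D \<subseteq> A \<Longrightarrow> is_sup P r D a \<Longrightarrow> a \<in> A"
  shows "A \<in> C_sigma P r"
  using assms dcpo_refl[OF assms(1)]
  unfolding C_sigma_def scott_closed_def down_set_def by blast

lemma empty_in_C_sigma: "dcpo P r \<Longrightarrow> {} \<in> C_sigma P r"
  by (rule C_sigmaI) (auto simp: directed_in_def)

lemma principal_in_C_sigma:
  assumes "dcpo P r" "x \<in> P"
  shows "down_set P r {x} \<in> C_sigma P r"
proof (rule C_sigmaI[OF assms(1)])
  fix D a assume "directed_in P r D" "D \<subseteq> down_set P r {x}" "is_sup P r D a"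
  then show "a \<in> down_set P r {x}"
    using assms(2) by (auto simp: is_sup_def down_set_def)
next
  fix y z assume "z \<in> down_set P r {x}" "(y, z) \<in> r"
  then show "y \<in> down_set P r {x}"
    using dcpo_trans[OF assms(1)] dcpo_carrier[OF assms(1)] unfolding down_set_def by blast
qed (auto simp: down_set_def)

text \<open>
  A directed set covered by two lower sets lies in one of them: an element outside the first
  and an element outside the second would have an upper bound outside both.
\<close>

lemma Un_in_C_sigma:
  assumes "dcpo P r" "A \<in> C_sigma P r" "B \<in> C_sigma P r"
  shows "A \<union> B \<in> C_sigma P r"
proof (rule C_sigmaI[OF assms(1)])
  show "A \<union> B \<subseteq> P" using assms C_sigma_carrier by blast
next
  fix x y assume "y \<in> A \<union> B" "(x, y) \<in> r"
  then show "x \<in> A \<union> B"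
    using assms C_sigma_lower dcpo_carrier by (metis Un_iff)
next
  fix D a assume D: "directed_in P r D" "D \<subseteq> A \<union> B" "is_sup P r D a"
  have "D \<subseteq> A \<or> D \<subseteq> B"
  proof (rule ccontr)
    assume "\<not> (D \<subseteq> A \<or> D \<subseteq> B)"
    then obtain u v where uv: "u \<in> D" "u \<notin> A" "v \<in> D" "v \<notin> B" by blast
    then obtain w where w: "w \<in> D" "(u, w) \<in> r" "(v, w) \<in> r"
      using D(1) unfolding directed_in_def by blast
    have "u \<in> P" "v \<in> P" using uv D(1) by (auto simp: directed_in_def)
    then have "w \<notin> A" "w \<notin> B"
      using w uv C_sigma_lower[OF assms(2)] C_sigma_lower[OF assms(3)] by blast+
    then show False using w D(2) by blast
  qed
  then show "a \<in> A \<union> B" using D assms C_sigma_sup by (metis Un_iff)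
qed

text \<open>
  Membership of a point in a closed set is expressed by the order of the lattice of closed sets,
  which is what an isomorphism of these lattices preserves.
\<close>

lemma principal_subset_iff:
  assumes "dcpo P r" "x \<in> P" "A \<in> C_sigma P r"
  shows "down_set P r {x} \<subseteq> A \<longleftrightarrow> x \<in> A"
  using assms dcpo_refl[OF assms(1,2)] C_sigma_lower[OF assms(3)]
  by (auto simp: down_set_def)

lemma principal_subset_principal_iff:
  assumes "dcpo P r" "x \<in> P" "y \<in> P"
  shows "down_set P r {x} \<subseteq> down_set P r {y} \<longleftrightarrow> (x, y) \<in> r"
  using principal_subset_iff[OF assms(1,2) principal_in_C_sigma[OF assms(1,3)]] assms(2)
  by (auto simp: down_set_def)

section \<open>Rudin's lemma\<close>

text \<open>
  The directed set is a minimal lower set \<open>M\<close> meeting every member of the family; Zorn's lemma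
  provides it because a finite set that meets every member of a chain of sets meets their
  intersection. By minimality, \<open>M - \<up>x\<close> misses some \<open>F\<close> of the family for each \<open>x \<in> M\<close>, so
  \<open>M \<inter> F \<subseteq> \<up>x\<close>. For \<open>x, y \<in> M\<close> with such sets \<open>F\<close> and \<open>G\<close>, any point of \<open>M\<close> in a member of the
  family inside \<open>\<up>F \<inter> \<up>G\<close> is an upper bound of \<open>x\<close> and \<open>y\<close>.
\<close>

lemma rudin:
  assumes P: "dcpo P r"
    and ne: "\<F> \<noteq> {}"
    and fin: "\<And>F. F \<in> \<F> \<Longrightarrow> finite F"
    and filt: "\<And>F G. F \<in> \<F> \<Longrightarrow> G \<in> \<F> \<Longrightarrow> \<exists>H\<in>\<F>. H \<subseteq> up_set P r F \<inter> up_set P r G"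
    and B: "B \<subseteq> P" "\<And>x y. y \<in> B \<Longrightarrow> (x, y) \<in> r \<Longrightarrow> x \<in> B"
    and meets: "\<And>F. F \<in> \<F> \<Longrightarrow> B \<inter> F \<noteq> {}"
  shows "\<exists>D. directed_in P r D \<and> D \<subseteq> B \<and> (\<forall>F\<in>\<F>. D \<inter> F \<noteq> {})"
proof -
  \<comment> \<open>Zorn's lemma yields maximal elements, so it is applied to the complements in \<open>B\<close>.\<close>
  define \<L> where "\<L> = {C. C \<subseteq> B \<and> (\<forall>x y. y \<in> B - C \<longrightarrow> (x, y) \<in> r \<longrightarrow> x \<in> B - C) \<and>
                           (\<forall>F\<in>\<F>. (B - C) \<inter> F \<noteq> {})}"
  have "\<exists>M\<in>\<L>. \<forall>X\<in>\<L>. M \<subseteq> X \<longrightarrow> X = M"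
  proof (rule subset_Zorn_nonempty)
    show "\<L> \<noteq> {}" using B(2) meets by (auto simp: \<L>_def intro!: exI[of _ "{}"])
  next
    fix \<C> assume \<C>: "\<C> \<noteq> {}" "subset.chain \<L> \<C>"
    have "(B - \<Union>\<C>) \<inter> F \<noteq> {}" if F: "F \<in> \<F>" for F
    proof
      assume "(B - \<Union>\<C>) \<inter> F = {}"
      then have "B \<inter> F \<subseteq> \<Union>\<C>" by blast
      then obtain C where "C \<in> \<C>" "B \<inter> F \<subseteq> C"
        using finite_subset_Union_chain[OF _ _ \<C>] fin[OF F] by (metis finite_Int)
      moreover have "C \<in> \<L>" using \<C>(2) \<open>C \<in> \<C>\<close> by (auto simp: subset.chain_def)
      then have "(B - C) \<inter> F \<noteq> {}" using F unfolding \<L>_def by blast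
      ultimately show False by blast
    qed
    moreover have \<C>_\<L>: "\<C> \<subseteq> \<L>" using \<C>(2) by (auto simp: subset.chain_def)
    then have "\<Union>\<C> \<subseteq> B" unfolding \<L>_def by blast
    moreover have "x \<in> B - \<Union>\<C>" if y: "y \<in> B - \<Union>\<C>" "(x, y) \<in> r" for x y
    proof -
      have "x \<in> B - C" if "C \<in> \<C>" for C
        using y that \<C>_\<L> unfolding \<L>_def by blast
      then show ?thesis using \<C>(1) by blast
    qed
    ultimately show "\<Union>\<C> \<in> \<L>" unfolding \<L>_def by blast
  qed
  then obtain C where C: "C \<in> \<L>" and max: "\<And>X. X \<in> \<L> \<Longrightarrow> C \<subseteq> X \<Longrightarrow> X = C" by blast
  define M where "M = B - C"
  have M_lower: "\<And>x y. y \<in> M \<Longrightarrow> (x, y) \<in> r \<Longrightarrow> x \<in> M"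
    and M_meets: "\<And>F. F \<in> \<F> \<Longrightarrow> M \<inter> F \<noteq> {}" and "M \<subseteq> B"
    using C unfolding \<L>_def M_def by blast+
  have cut: "\<exists>F\<in>\<F>. \<forall>f\<in>M \<inter> F. (x, f) \<in> r" if x: "x \<in> M" for x
  proof (rule ccontr)
    assume "\<not> ?thesis"
    then have *: "\<And>F. F \<in> \<F> \<Longrightarrow> \<exists>f\<in>M \<inter> F. (x, f) \<notin> r" by blast
    define X where "X = C \<union> {y \<in> B. (x, y) \<in> r}"
    have X: "B - X = {y \<in> M. (x, y) \<notin> r}" by (auto simp: X_def M_def)
    have "C \<subseteq> B" using C unfolding \<L>_def by blast
    then have "X \<subseteq> B" by (auto simp: X_def)
    moreover have "u \<in> B - X" if "v \<in> B - X" "(u, v) \<in> r" for u v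
      using that M_lower dcpo_trans[OF P] unfolding X by blast
    moreover have "(B - X) \<inter> F \<noteq> {}" if "F \<in> \<F>" for F
      using *[OF that] unfolding X by blast
    ultimately have "X \<in> \<L>" unfolding \<L>_def by blast
    then have "X = C" using max by (auto simp: X_def)
    then show False
      using x dcpo_refl[OF P, of x] B(1) by (auto simp: X_def M_def)
  qed
  have "directed_in P r M"
    unfolding directed_in_def
  proof (intro conjI ballI)
    show "M \<subseteq> P" using \<open>M \<subseteq> B\<close> B(1) by blast
    show "M \<noteq> {}" using ne M_meets by blast
  next
    fix x y assume "x \<in> M" "y \<in> M"
    then obtain F G where FG: "F \<in> \<F>" "G \<in> \<F>"
      and xF: "\<And>f. f \<in> M \<inter> F \<Longrightarrow> (x, f) \<in> r" and yG: "\<And>g. g \<in> M \<inter> G \<Longrightarrow> (y, g) \<in> r"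
      using cut by meson
    then obtain H where H: "H \<in> \<F>" "H \<subseteq> up_set P r F \<inter> up_set P r G" using filt by blast
    then obtain h where h: "h \<in> M" "h \<in> H" using M_meets by blast
    then obtain f g where fg: "f \<in> F" "(f, h) \<in> r" "g \<in> G" "(g, h) \<in> r"
      using H(2) unfolding up_set_def by blast
    then have "f \<in> M \<inter> F" "g \<in> M \<inter> G" using M_lower h by auto
    then have "(x, h) \<in> r" "(y, h) \<in> r" using xF yG fg dcpo_trans[OF P] by blast+
    then show "\<exists>z\<in>M. (x, z) \<in> r \<and> (y, z) \<in> r" using h by blast
  qed
  then show ?thesis using \<open>M \<subseteq> B\<close> M_meets by blast
qed

section \<open>Local hypercompactness\<close>

text \<open>
  Open sets are given by their closed complements, so that the isomorphism of the lattices of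
  closed sets applies directly: \<open>P - C\<close> is the neighbourhood of \<open>x\<close>, and \<open>P - B\<close> is an open
  neighbourhood of \<open>x\<close> witnessing that \<open>x\<close> is interior to \<open>\<up>F\<close>.
\<close>

definition locally_hypercompact :: "'a set \<Rightarrow> 'a rel \<Rightarrow> bool" where
  "locally_hypercompact P r \<longleftrightarrow>
     (\<forall>x\<in>P. \<forall>C\<in>C_sigma P r. x \<notin> C \<longrightarrow>
        (\<exists>F. finite F \<and> F \<subseteq> P - C \<and> (\<exists>B\<in>C_sigma P r. x \<notin> B \<and> P - B \<subseteq> up_set P r F)))"

lemma locally_hypercompactE:
  assumes "locally_hypercompact P r" "x \<in> P" "C \<in> C_sigma P r" "x \<notin> C"
  obtains F B where "finite F" "F \<subseteq> P - C" "B \<in> C_sigma P r" "x \<notin> B" "P - B \<subseteq> up_set P r F"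
proof -
  have "\<exists>F. finite F \<and> F \<subseteq> P - C \<and> (\<exists>B\<in>C_sigma P r. x \<notin> B \<and> P - B \<subseteq> up_set P r F)"
    using assms unfolding locally_hypercompact_def by simp
  then show thesis using that by blast
qed

lemma way_below_upper:
  assumes "dcpo P r" "way_below P r F x" "(x, y) \<in> r"
  shows "way_below P r F y"
  using assms(2) dcpo_trans[OF assms(1,3)] unfolding way_below_def by blast

lemma way_below_refine:
  assumes P: "dcpo P r" and F: "way_below P r F x" "F \<subseteq> up_set P r G"
  shows "way_below P r G x"
proof -
  have "up_set P r F \<subseteq> up_set P r G"
    using F(2) dcpo_trans[OF P] by (fastforce simp: up_set_def)
  then show ?thesis using F(1) unfolding way_below_def by blast
qed

text \<open>
  The shared core of interpolation and of approximation inside open sets. The sets in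
  \<open>fin d\<close>, \<open>d \<in> D\<close>, form a filtered family, so Rudin's lemma extracts from \<open>B\<close> a directed set
  meeting all of them. Its supremum lies above every \<open>d \<in> D\<close>, since otherwise some member of
  \<open>fin d\<close> would separate it from \<open>d\<close>.
\<close>

lemma quasicontinuous_directed_selection:
  assumes qc: "quasicontinuous P r" and D: "directed_in P r D" "is_sup P r D s"
    and B: "B \<subseteq> P" "\<And>x y. y \<in> B \<Longrightarrow> (x, y) \<in> r \<Longrightarrow> x \<in> B"
    and meets: "\<And>d F. d \<in> D \<Longrightarrow> F \<in> fin P r d \<Longrightarrow> B \<inter> F \<noteq> {}"
  shows "\<exists>A a. directed_in P r A \<and> A \<subseteq> B \<and> is_sup P r A a \<and> (s, a) \<in> r"
proof -
  have P: "dcpo P r" using qc by (simp add: quasicontinuous_def)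
  have DP: "D \<subseteq> P" "D \<noteq> {}" using D(1) by (auto simp: directed_in_def)
  let ?\<F> = "\<Union>d\<in>D. fin P r d"
  have filt: "\<exists>H\<in>?\<F>. H \<subseteq> up_set P r F \<inter> up_set P r G" if FG: "F \<in> ?\<F>" "G \<in> ?\<F>" for F G
  proof -
    from FG obtain x y where xy: "x \<in> D" "F \<in> fin P r x" "y \<in> D" "G \<in> fin P r y" by blast
    then obtain d where d: "d \<in> D" "(x, d) \<in> r" "(y, d) \<in> r"
      using D(1) unfolding directed_in_def by blast
    have "F \<in> fin P r d" "G \<in> fin P r d"
      using xy d way_below_upper[OF P, of F x d] way_below_upper[OF P, of G y d]
      by (auto simp: fin_def)
    moreover have "d \<in> P" using d DP by blast
    ultimately have "\<exists>H\<in>fin P r d. H \<subseteq> up_set P r F \<inter> up_set P r G"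
      using qc unfolding quasicontinuous_def by blast
    then show ?thesis using d by blast
  qed
  have "\<exists>A. directed_in P r A \<and> A \<subseteq> B \<and> (\<forall>F\<in>?\<F>. A \<inter> F \<noteq> {})"
  proof (rule rudin[OF P _ _ filt B])
    show "?\<F> \<noteq> {}" using qc DP unfolding quasicontinuous_def by blast
    show "finite F" if "F \<in> ?\<F>" for F using that by (auto simp: fin_def)
    show "B \<inter> F \<noteq> {}" if "F \<in> ?\<F>" for F using that meets by blast
  qed
  then obtain A where A: "directed_in P r A" "A \<subseteq> B" "\<forall>F\<in>?\<F>. A \<inter> F \<noteq> {}" by blast
  obtain a where a: "is_sup P r A a" using dcpo_sup[OF P A(1)] .
  have "(d, a) \<in> r" if d: "d \<in> D" for d
  proof (rule ccontr)
    assume "(d, a) \<notin> r"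
    then obtain F where F: "F \<in> fin P r d" "a \<notin> up_set P r F"
      using qc d DP a unfolding quasicontinuous_def is_sup_def by blast
    then obtain f where "f \<in> A" "f \<in> F" using A(3) d by blast
    then show False using F a by (auto simp: up_set_def is_sup_def)
  qed
  then have "(s, a) \<in> r" using D(2) a by (auto simp: is_sup_def)
  then show ?thesis using A a by blast
qed

text \<open>
  This is interpolation: a finite set way below the supremum of a directed set \<open>D\<close> is already way
  below some \<open>d \<in> D\<close>. Otherwise no member of any \<open>fin d\<close> is contained in \<open>\<up>F\<close>, so a directed set
  can be selected outside \<open>\<up>F\<close> whose supremum lies above that of \<open>D\<close>, contrary to \<open>F\<close> being way
  below the latter.
\<close>

lemma quasicontinuous_not_way_below_closed:
  assumes qc: "quasicontinuous P r"
  shows "{y \<in> P. \<not> way_below P r F y} \<in> C_sigma P r"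
proof -
  have P: "dcpo P r" using qc by (simp add: quasicontinuous_def)
  show ?thesis
  proof (rule C_sigmaI[OF P])
    fix D s assume D: "directed_in P r D" "D \<subseteq> {y \<in> P. \<not> way_below P r F y}" "is_sup P r D s"
    have "\<not> way_below P r F s"
    proof
      assume wb: "way_below P r F s"
      have meets: "(P - up_set P r F) \<inter> G \<noteq> {}" if G: "d \<in> D" "G \<in> fin P r d" for d G
      proof
        assume "(P - up_set P r F) \<inter> G = {}"
        then have "G \<subseteq> up_set P r F" using G(2) by (auto simp: fin_def)
        then have "way_below P r F d"
          using G(2) way_below_refine[OF P, of G d F] by (simp add: fin_def)
        then show False using G D(2) by blast
      qed
      have "\<exists>A a. directed_in P r A \<and> A \<subseteq> P - up_set P r F \<and> is_sup P r A a \<and> (s, a) \<in> r"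
      proof (rule quasicontinuous_directed_selection[OF qc D(1,3) _ _ meets])
        fix x y assume "y \<in> P - up_set P r F" "(x, y) \<in> r"
        then show "x \<in> P - up_set P r F"
          using dcpo_trans[OF P _ \<open>(x, y) \<in> r\<close>] dcpo_carrier[OF P \<open>(x, y) \<in> r\<close>]
          unfolding up_set_def by blast
      qed auto
      then show False using wb unfolding way_below_def by blast
    qed
    then show "s \<in> {y \<in> P. \<not> way_below P r F y}" using D(3) by (auto simp: is_sup_def)
  next
    fix x y assume "y \<in> {y \<in> P. \<not> way_below P r F y}" "(x, y) \<in> r"
    then show "x \<in> {y \<in> P. \<not> way_below P r F y}"
      using way_below_upper[OF P, of F x y] dcpo_carrier[OF P, of x y] by auto
  qed auto
qed

text \<open>
  Some \<open>F \<in> fin x\<close> lies inside a given open neighbourhood of \<open>x\<close>: if all of them met its closed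
  complement, selecting a directed set there would put \<open>x\<close> below the supremum of that
  set, hence into the complement.
\<close>

lemma quasicontinuous_imp_locally_hypercompact:
  assumes qc: "quasicontinuous P r"
  shows "locally_hypercompact P r"
  unfolding locally_hypercompact_def
proof (intro ballI impI)
  fix x C assume x: "x \<in> P" and C: "C \<in> C_sigma P r" and xC: "x \<notin> C"
  have P: "dcpo P r" using qc by (simp add: quasicontinuous_def)
  have "\<exists>F\<in>fin P r x. C \<inter> F = {}"
  proof (rule ccontr)
    assume "\<not> ?thesis"
    then have meets: "\<And>d F. d \<in> {x} \<Longrightarrow> F \<in> fin P r d \<Longrightarrow> C \<inter> F \<noteq> {}" by blast
    have D: "directed_in P r {x}" "is_sup P r {x} x"
      using x dcpo_refl[OF P] by (auto simp: directed_in_def is_sup_def)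
    have "\<exists>A a. directed_in P r A \<and> A \<subseteq> C \<and> is_sup P r A a \<and> (x, a) \<in> r"
    proof (rule quasicontinuous_directed_selection[OF qc D C_sigma_carrier[OF C] _ meets])
      show "u \<in> C" if "v \<in> C" "(u, v) \<in> r" for u v
        using C_sigma_lower[OF C that] dcpo_carrier[OF P that(2)] by blast
    qed
    then show False using C_sigma_sup[OF C] C_sigma_lower[OF C] x xC by blast
  qed
  then obtain F where F: "F \<in> fin P r x" "C \<inter> F = {}" by blast
  let ?B = "{y \<in> P. \<not> way_below P r F y}"
  have "P - ?B \<subseteq> up_set P r F"
  proof
    fix y assume "y \<in> P - ?B"
    then have y: "y \<in> P" "way_below P r F y" by auto
    moreover have "directed_in P r {y}" "is_sup P r {y} y" "(y, y) \<in> r"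
      using y dcpo_refl[OF P] by (auto simp: directed_in_def is_sup_def)
    ultimately show "y \<in> up_set P r F" unfolding way_below_def by blast
  qed
  moreover have "x \<notin> ?B" "finite F" "F \<subseteq> P - C" using F by (auto simp: fin_def)
  ultimately show "\<exists>F. finite F \<and> F \<subseteq> P - C \<and>
      (\<exists>B\<in>C_sigma P r. x \<notin> B \<and> P - B \<subseteq> up_set P r F)"
    using quasicontinuous_not_way_below_closed[OF qc, of F]
    by (intro exI[of _ F] bexI[of _ ?B] conjI)
qed

section \<open>Sobriety\<close>

text \<open>
  The finite sets \<open>F\<close> such that \<open>K\<close> meets the interior of \<open>\<up>F\<close> form a filtered family: by
  irreducibility \<open>K\<close> meets the intersection of two such interiors, and local hypercompactness at a
  common point supplies a third set. Each of these sets meets the lower set \<open>K\<close>, so Rudin's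
  lemma gives a directed subset of \<open>K\<close>; its supremum is the greatest element of \<open>K\<close>.
\<close>

lemma irreducible_closed_is_principal:
  assumes P: "dcpo P r" and lh: "locally_hypercompact P r"
    and K: "K \<in> C_sigma P r" "K \<noteq> {}"
    and irr: "\<And>A B. A \<in> C_sigma P r \<Longrightarrow> B \<in> C_sigma P r \<Longrightarrow> K \<subseteq> A \<union> B \<Longrightarrow> K \<subseteq> A \<or> K \<subseteq> B"
  shows "\<exists>a\<in>P. K = down_set P r {a}"
proof -
  have KP: "K \<subseteq> P" using C_sigma_carrier[OF K(1)] .
  define \<F> where
    "\<F> = {F. finite F \<and> F \<subseteq> P \<and> (\<exists>B\<in>C_sigma P r. \<not> K \<subseteq> B \<and> P - B \<subseteq> up_set P r F)}"
  have ex: "\<exists>F\<in>\<F>. F \<subseteq> P - C" if C: "C \<in> C_sigma P r" "\<not> K \<subseteq> C" for C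
  proof -
    obtain x where x: "x \<in> K" "x \<notin> C" using C by blast
    have "x \<in> P" using x(1) KP by blast
    then obtain F B where F: "finite F" "F \<subseteq> P - C"
      and B: "B \<in> C_sigma P r" "x \<notin> B" "P - B \<subseteq> up_set P r F"
      using locally_hypercompactE[OF lh _ C(1) x(2)] by metis
    have "\<not> K \<subseteq> B" using x(1) B(2) by blast
    then have "F \<in> \<F>" using F B(1,3) unfolding \<F>_def by blast
    then show ?thesis using F(2) by blast
  qed
  have filt: "\<exists>H\<in>\<F>. H \<subseteq> up_set P r F \<inter> up_set P r G" if FG: "F \<in> \<F>" "G \<in> \<F>" for F G
  proof -
    obtain A where A: "A \<in> C_sigma P r" "\<not> K \<subseteq> A" "P - A \<subseteq> up_set P r F"
      using FG(1) by (auto simp: \<F>_def)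
    obtain B where B: "B \<in> C_sigma P r" "\<not> K \<subseteq> B" "P - B \<subseteq> up_set P r G"
      using FG(2) by (auto simp: \<F>_def)
    have "\<not> K \<subseteq> A \<union> B" using irr[OF A(1) B(1)] A(2) B(2) by blast
    then obtain H where H: "H \<in> \<F>" "H \<subseteq> P - (A \<union> B)"
      using ex[OF Un_in_C_sigma[OF P A(1) B(1)]] by blast
    have "P - (A \<union> B) \<subseteq> up_set P r F \<inter> up_set P r G" using A(3) B(3) by blast
    then have "H \<subseteq> up_set P r F \<inter> up_set P r G" by (rule subset_trans[OF H(2)])
    then show ?thesis by (rule bexI[OF _ H(1)])
  qed
  have meets: "K \<inter> F \<noteq> {}" if F: "F \<in> \<F>" for F
  proof -
    obtain x where x: "x \<in> K" "x \<in> up_set P r F" using F KP unfolding \<F>_def by blast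
    then obtain f where f: "f \<in> F" "(f, x) \<in> r" by (auto simp: up_set_def)
    then have "f \<in> K" using C_sigma_lower[OF K(1) x(1) f(2)] dcpo_carrier[OF P f(2)] by blast
    then show ?thesis using f(1) by blast
  qed
  have "\<exists>D. directed_in P r D \<and> D \<subseteq> K \<and> (\<forall>F\<in>\<F>. D \<inter> F \<noteq> {})"
  proof (rule rudin[OF P _ _ filt KP _ meets])
    show "\<F> \<noteq> {}" using ex[OF empty_in_C_sigma[OF P]] K(2) by blast
    show "finite F" if "F \<in> \<F>" for F using that by (simp add: \<F>_def)
    show "x \<in> K" if "y \<in> K" "(x, y) \<in> r" for x y
      using C_sigma_lower[OF K(1) that] dcpo_carrier[OF P that(2)] by blast
  qed
  then obtain D where D: "directed_in P r D" "D \<subseteq> K" "\<forall>F\<in>\<F>. D \<inter> F \<noteq> {}" by blast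
  obtain a where a: "is_sup P r D a" using dcpo_sup[OF P D(1)] .
  have aP: "a \<in> P" and aK: "a \<in> K" using a C_sigma_sup[OF K(1) D(1,2) a] by (auto simp: is_sup_def)
  have "K \<subseteq> down_set P r {a}"
  proof (rule ccontr)
    assume "\<not> ?thesis"
    then obtain F where F: "F \<in> \<F>" "F \<subseteq> P - down_set P r {a}"
      using ex[OF principal_in_C_sigma[OF P aP]] by blast
    then obtain f where "f \<in> D" "f \<in> F" using D(3) by blast
    then show False using F(2) a by (auto simp: down_set_def is_sup_def)
  qed
  then have "K = down_set P r {a}"
    using principal_subset_iff[OF P aP K(1)] aK by blast
  then show ?thesis using aP by blast
qed

section \<open>Isomorphisms of lattices of Scott closed sets\<close>

text \<open>
  An isomorphism together with its inverse, encoded as an adjunction in both directions. This form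
  is symmetric, so each fact about \<open>\<phi>\<close> is also available for \<open>\<psi>\<close>.
\<close>

definition closed_set_isos ::
    "'a set \<Rightarrow> 'a rel \<Rightarrow> 'b set \<Rightarrow> 'b rel \<Rightarrow> ('a set \<Rightarrow> 'b set) \<Rightarrow> ('b set \<Rightarrow> 'a set) \<Rightarrow> bool" where
  "closed_set_isos P r Q s \<phi> \<psi> \<longleftrightarrow>
     (\<forall>A\<in>C_sigma P r. \<phi> A \<in> C_sigma Q s) \<and> (\<forall>B\<in>C_sigma Q s. \<psi> B \<in> C_sigma P r) \<and>
     (\<forall>A\<in>C_sigma P r. \<forall>B\<in>C_sigma Q s. (\<phi> A \<subseteq> B \<longleftrightarrow> A \<subseteq> \<psi> B) \<and> (B \<subseteq> \<phi> A \<longleftrightarrow> \<psi> B \<subseteq> A))"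

lemma closed_set_isos_sym:
  assumes "closed_set_isos P r Q s \<phi> \<psi>"
  shows "closed_set_isos Q s P r \<psi> \<phi>"
proof -
  have "\<phi> A \<subseteq> B \<longleftrightarrow> A \<subseteq> \<psi> B" "B \<subseteq> \<phi> A \<longleftrightarrow> \<psi> B \<subseteq> A"
    if "A \<in> C_sigma P r" "B \<in> C_sigma Q s" for A B
    using assms that by (simp_all add: closed_set_isos_def)
  moreover have "\<forall>A\<in>C_sigma P r. \<phi> A \<in> C_sigma Q s" "\<forall>B\<in>C_sigma Q s. \<psi> B \<in> C_sigma P r"
    using assms by (simp_all add: closed_set_isos_def)
  ultimately show ?thesis by (simp add: closed_set_isos_def)
qed

lemma
  assumes "closed_set_isos P r Q s \<phi> \<psi>" "A \<in> C_sigma P r"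
  shows closed_set_isos_closed: "\<phi> A \<in> C_sigma Q s"
    and closed_set_isos_inverse: "\<psi> (\<phi> A) = A"
    and closed_set_isos_adjoint: "B \<in> C_sigma Q s \<Longrightarrow> \<phi> A \<subseteq> B \<longleftrightarrow> A \<subseteq> \<psi> B"
    and closed_set_isos_mono_iff: "A' \<in> C_sigma P r \<Longrightarrow> \<phi> A \<subseteq> \<phi> A' \<longleftrightarrow> A \<subseteq> A'"
proof -
  have \<phi>: "\<And>A. A \<in> C_sigma P r \<Longrightarrow> \<phi> A \<in> C_sigma Q s"
    and adj: "\<And>A B. A \<in> C_sigma P r \<Longrightarrow> B \<in> C_sigma Q s \<Longrightarrow> \<phi> A \<subseteq> B \<longleftrightarrow> A \<subseteq> \<psi> B"
    and adj': "\<And>A B. A \<in> C_sigma P r \<Longrightarrow> B \<in> C_sigma Q s \<Longrightarrow> B \<subseteq> \<phi> A \<longleftrightarrow> \<psi> B \<subseteq> A"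
    using assms(1) by (simp_all add: closed_set_isos_def)
  have inv: "\<psi> (\<phi> A) = A" if A: "A \<in> C_sigma P r" for A
    using adj[OF A \<phi>[OF A]] adj'[OF A \<phi>[OF A]] by (intro subset_antisym) simp_all
  show "\<phi> A \<in> C_sigma Q s" using \<phi>[OF assms(2)] .
  show "\<psi> (\<phi> A) = A" using inv[OF assms(2)] .
  show "\<phi> A \<subseteq> B \<longleftrightarrow> A \<subseteq> \<psi> B" if "B \<in> C_sigma Q s" using adj[OF assms(2) that] .
  show "\<phi> A \<subseteq> \<phi> A' \<longleftrightarrow> A \<subseteq> A'" if "A' \<in> C_sigma P r"
    using adj[OF assms(2) \<phi>[OF that]] inv[OF that] by simp
qed

lemma closed_set_isos_of_order_isomorphic:
  assumes "order_isomorphic (C_sigma P r) (inclusion_on (C_sigma P r))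
             (C_sigma Q s) (inclusion_on (C_sigma Q s))"
  obtains \<phi> \<psi> where "closed_set_isos P r Q s \<phi> \<psi>"
proof -
  obtain \<phi> where bij: "bij_betw \<phi> (C_sigma P r) (C_sigma Q s)"
    and incl: "\<forall>A\<in>C_sigma P r. \<forall>B\<in>C_sigma P r.
      (A, B) \<in> inclusion_on (C_sigma P r) \<longleftrightarrow> (\<phi> A, \<phi> B) \<in> inclusion_on (C_sigma Q s)"
    using assms unfolding order_isomorphic_def by blast
  let ?\<psi> = "inv_into (C_sigma P r) \<phi>"
  have \<phi>: "\<phi> A \<in> C_sigma Q s" if "A \<in> C_sigma P r" for A
    using bij_betw_apply[OF bij that] .
  have \<psi>: "?\<psi> B \<in> C_sigma P r" "\<phi> (?\<psi> B) = B" if "B \<in> C_sigma Q s" for B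
    using bij that by (auto simp: bij_betw_def inv_into_into f_inv_into_f)
  have "A \<subseteq> B \<longleftrightarrow> \<phi> A \<subseteq> \<phi> B" if "A \<in> C_sigma P r" "B \<in> C_sigma P r" for A B
    using incl that \<phi> by (auto simp: inclusion_on_def relation_of_def)
  then have "closed_set_isos P r Q s \<phi> ?\<psi>"
    unfolding closed_set_isos_def using \<phi> \<psi> by metis
  then show thesis by (rule that)
qed

text \<open>
  Given \<open>q \<notin> C\<close>, local hypercompactness is applied at a point of \<open>\<psi> (\<down>q)\<close> outside \<open>\<psi> C\<close>. Each
  \<open>f \<in> F\<close> is replaced by a point \<open>g f\<close> of \<open>\<phi> (\<down>f)\<close> outside \<open>C\<close>. A point \<open>y\<close> outside \<open>\<phi> B\<close> is above
  some \<open>g f\<close>, because \<open>\<psi> (\<down>y)\<close> contains a point outside \<open>B\<close>, which lies above some \<open>f \<in> F\<close>,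
  and so \<open>\<phi> (\<down>f) \<subseteq> \<down>y\<close>.
\<close>

lemma locally_hypercompact_transfer:
  assumes P: "dcpo P r" and Q: "dcpo Q s" and iso: "closed_set_isos P r Q s \<phi> \<psi>"
    and lh: "locally_hypercompact P r"
  shows "locally_hypercompact Q s"
  unfolding locally_hypercompact_def
proof (intro ballI impI)
  fix q C assume q: "q \<in> Q" and C: "C \<in> C_sigma Q s" and qC: "q \<notin> C"
  note iso' = closed_set_isos_sym[OF iso]
  have pQ: "down_set Q s {y} \<in> C_sigma Q s" if "y \<in> Q" for y
    using principal_in_C_sigma[OF Q that] .
  have "\<not> \<psi> (down_set Q s {q}) \<subseteq> \<psi> C"
    using closed_set_isos_mono_iff[OF iso' pQ[OF q] C] principal_subset_iff[OF Q q C] qC by simp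
  then obtain x where x: "x \<in> \<psi> (down_set Q s {q})" "x \<notin> \<psi> C" by blast
  have xP: "x \<in> P" using x(1) C_sigma_carrier closed_set_isos_closed[OF iso' pQ[OF q]] by blast
  obtain F B where F: "finite F" "F \<subseteq> P - \<psi> C" and B: "B \<in> C_sigma P r" "x \<notin> B"
    and up: "P - B \<subseteq> up_set P r F"
    using locally_hypercompactE[OF lh xP closed_set_isos_closed[OF iso' C] x(2)] .
  have "\<exists>y. y \<in> \<phi> (down_set P r {f}) \<and> y \<notin> C" if f: "f \<in> F" for f
  proof -
    have "f \<in> P" "f \<notin> \<psi> C" using f F by auto
    then have "\<not> down_set P r {f} \<subseteq> \<psi> C"
      using principal_subset_iff[OF P _ closed_set_isos_closed[OF iso' C]] by blast
    then show ?thesis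
      using closed_set_isos_adjoint[OF iso principal_in_C_sigma[OF P \<open>f \<in> P\<close>] C] by blast
  qed
  then obtain g where g: "\<And>f. f \<in> F \<Longrightarrow> g f \<in> \<phi> (down_set P r {f}) \<and> g f \<notin> C" by metis
  have gQ: "g ` F \<subseteq> Q - C"
  proof
    fix y assume "y \<in> g ` F"
    then obtain f where "f \<in> F" "y = g f" by blast
    moreover have "\<phi> (down_set P r {f}) \<subseteq> Q"
      using \<open>f \<in> F\<close> F principal_in_C_sigma[OF P] closed_set_isos_closed[OF iso] C_sigma_carrier
      by (metis DiffD1 subsetD)
    ultimately show "y \<in> Q - C" using g by blast
  qed
  have above: "\<exists>p\<in>\<psi> (down_set Q s {y}). p \<notin> B" if "y \<in> Q" "y \<notin> \<phi> B" for y
  proof -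
    have "\<not> down_set Q s {y} \<subseteq> \<phi> B"
      using principal_subset_iff[OF Q that(1) closed_set_isos_closed[OF iso B(1)]] that by blast
    then show ?thesis using closed_set_isos_adjoint[OF iso' pQ[OF that(1)] B(1)] by blast
  qed
  have "Q - \<phi> B \<subseteq> up_set Q s (g ` F)"
  proof
    fix y assume y: "y \<in> Q - \<phi> B"
    then obtain p where p: "p \<in> \<psi> (down_set Q s {y})" "p \<notin> B" using above by blast
    have y_closed: "\<psi> (down_set Q s {y}) \<in> C_sigma P r"
      using closed_set_isos_closed[OF iso'] pQ y by blast
    then have "p \<in> P" using p C_sigma_carrier by blast
    then obtain f where f: "f \<in> F" "(f, p) \<in> r" using up p by (auto simp: up_set_def)
    have fP: "f \<in> P" using f F by blast
    have "f \<in> \<psi> (down_set Q s {y})" using C_sigma_lower[OF y_closed p(1) f(2) fP] .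
    then have "down_set P r {f} \<subseteq> \<psi> (down_set Q s {y})"
      using principal_subset_iff[OF P fP y_closed] by blast
    then have "\<phi> (down_set P r {f}) \<subseteq> down_set Q s {y}"
      using closed_set_isos_adjoint[OF iso principal_in_C_sigma[OF P fP]] pQ y by blast
    then have "(g f, y) \<in> s" using g[OF f(1)] by (auto simp: down_set_def)
    then show "y \<in> up_set Q s (g ` F)" using f y by (auto simp: up_set_def)
  qed
  moreover have "q \<notin> \<phi> B"
  proof
    assume "q \<in> \<phi> B"
    then have "down_set Q s {q} \<subseteq> \<phi> B"
      using principal_subset_iff[OF Q q closed_set_isos_closed[OF iso B(1)]] by blast
    then show False using closed_set_isos_adjoint[OF iso' pQ[OF q] B(1)] x(1) B(2) by blast
  qed
  ultimately show "\<exists>F. finite F \<and> F \<subseteq> Q - C \<and>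
      (\<exists>B\<in>C_sigma Q s. q \<notin> B \<and> Q - B \<subseteq> up_set Q s F)"
    using F(1) gQ closed_set_isos_closed[OF iso B(1)] by blast
qed

text \<open>
  A principal ideal is irreducible in the lattice of closed sets, and so is its image, which is
  therefore principal by sobriety of the target.
\<close>

lemma closed_set_isos_principal:
  assumes P: "dcpo P r" and Q: "dcpo Q s" and iso: "closed_set_isos P r Q s \<phi> \<psi>"
    and lh: "locally_hypercompact Q s" and p: "p \<in> P"
  shows "\<exists>q\<in>Q. \<phi> (down_set P r {p}) = down_set Q s {q}"
proof (rule irreducible_closed_is_principal[OF Q lh])
  note iso' = closed_set_isos_sym[OF iso]
  note dp = principal_in_C_sigma[OF P p]
  have mem: "\<phi> (down_set P r {p}) \<subseteq> B \<longleftrightarrow> p \<in> \<psi> B" if "B \<in> C_sigma Q s" for B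
    using closed_set_isos_adjoint[OF iso dp that]
      principal_subset_iff[OF P p closed_set_isos_closed[OF iso' that]] by simp
  show "\<phi> (down_set P r {p}) \<in> C_sigma Q s" using closed_set_isos_closed[OF iso dp] .
  show "\<phi> (down_set P r {p}) \<noteq> {}"
  proof
    assume "\<phi> (down_set P r {p}) = {}"
    then have "\<phi> (down_set P r {p}) \<subseteq> \<phi> {}" by simp
    then have "down_set P r {p} \<subseteq> {}"
      using closed_set_isos_mono_iff[OF iso dp empty_in_C_sigma[OF P]] by blast
    then show False using principal_subset_iff[OF P p empty_in_C_sigma[OF P]] by blast
  qed
  fix A B assume A: "A \<in> C_sigma Q s" and B: "B \<in> C_sigma Q s"
    and sub: "\<phi> (down_set P r {p}) \<subseteq> A \<union> B"
  note \<psi>A = closed_set_isos_closed[OF iso' A] and \<psi>B = closed_set_isos_closed[OF iso' B]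
  note U = Un_in_C_sigma[OF P \<psi>A \<psi>B]
  \<comment> \<open>Unions are joins in the lattice of closed sets, so \<open>\<psi>\<close> carries \<open>A \<union> B\<close> to \<open>\<psi> A \<union> \<psi> B\<close>; one
      inclusion suffices here.\<close>
  have "A \<union> B \<subseteq> \<phi> (\<psi> A \<union> \<psi> B)"
    using closed_set_isos_adjoint[OF iso' A U] closed_set_isos_adjoint[OF iso' B U] by blast
  then have "\<phi> (down_set P r {p}) \<subseteq> \<phi> (\<psi> A \<union> \<psi> B)" using sub by blast
  then have "p \<in> \<psi> A \<union> \<psi> B"
    using closed_set_isos_mono_iff[OF iso dp U] principal_subset_iff[OF P p U] by blast
  then show "\<phi> (down_set P r {p}) \<subseteq> A \<or> \<phi> (down_set P r {p}) \<subseteq> B"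
    using mem[OF A] mem[OF B] by blast
qed

text \<open>
  The isomorphism sends \<open>p\<close> to the generator of \<open>\<phi> (\<down>p)\<close>. It is surjective because \<open>\<psi>\<close> also preserves
  principal ideals, for which \<open>P\<close> has to be sober as well.
\<close>

lemma order_isomorphic_of_closed_set_isos:
  assumes P: "dcpo P r" and Q: "dcpo Q s" and iso: "closed_set_isos P r Q s \<phi> \<psi>"
    and lhP: "locally_hypercompact P r" and lhQ: "locally_hypercompact Q s"
  shows "order_isomorphic P r Q s"
proof -
  note iso' = closed_set_isos_sym[OF iso]
  obtain f where f: "\<And>p. p \<in> P \<Longrightarrow> f p \<in> Q \<and> \<phi> (down_set P r {p}) = down_set Q s {f p}"
    using closed_set_isos_principal[OF P Q iso lhQ] by metis
  have le: "(x, y) \<in> r \<longleftrightarrow> (f x, f y) \<in> s" if "x \<in> P" "y \<in> P" for x y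
    using closed_set_isos_mono_iff[OF iso principal_in_C_sigma[OF P that(1)]
        principal_in_C_sigma[OF P that(2)]]
      f[OF that(1)] f[OF that(2)] principal_subset_principal_iff[OF P that]
      principal_subset_principal_iff[OF Q, of "f x" "f y"] by simp
  have "inj_on f P"
    using le dcpo_antisym[OF P] dcpo_refl[OF P] by (metis inj_onI)
  moreover have "f ` P = Q"
  proof
    show "f ` P \<subseteq> Q" using f by blast
    show "Q \<subseteq> f ` P"
    proof
      fix q assume q: "q \<in> Q"
      obtain p where p: "p \<in> P" "\<psi> (down_set Q s {q}) = down_set P r {p}"
        using closed_set_isos_principal[OF Q P iso' lhP q] by blast
      have "down_set Q s {f p} = down_set Q s {q}"
        using closed_set_isos_inverse[OF iso' principal_in_C_sigma[OF Q q]] p f by simp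
      then have "f p = q"
        using principal_subset_principal_iff[OF Q] q f[OF p(1)] dcpo_antisym[OF Q]
        by (metis order_refl)
      then show "q \<in> f ` P" using p by blast
    qed
  qed
  ultimately show ?thesis using le unfolding order_isomorphic_def bij_betw_def by blast
qed

theorem lemma3p8:
  fixes P :: "'a set" and r :: "'a rel"
  assumes "quasicontinuous P r"
  shows "C_sigma_unique TYPE('b) P r"
  unfolding C_sigma_unique_def
proof (intro conjI allI impI)
  show P: "dcpo P r" using assms by (simp add: quasicontinuous_def)
  fix Q :: "'b set" and s
  assume Q: "dcpo Q s"
    and "order_isomorphic (C_sigma P r) (inclusion_on (C_sigma P r))
           (C_sigma Q s) (inclusion_on (C_sigma Q s))"
  then obtain \<phi> \<psi> where iso: "closed_set_isos P r Q s \<phi> \<psi>"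
    using closed_set_isos_of_order_isomorphic by blast
  have lh: "locally_hypercompact P r"
    using quasicontinuous_imp_locally_hypercompact[OF assms] .
  show "order_isomorphic P r Q s"
    using order_isomorphic_of_closed_set_isos[OF P Q iso lh
        locally_hypercompact_transfer[OF P Q iso lh]] .
qed

end
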